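(* Assume Conjecture A (stated in the context). Then there is an algorithm which takes as input a Diophantine equation $D(x_1,\ldots,x_p)=0$ with $D\in\mathbb{Z}[x_1,\ldots,x_p]$ and returns an integer $b$ with the following property: if the equation $D(x_1,\ldots,x_p)=0$ has only finitely many rational solutions, then every solution $(x_1,\ldots,x_p)\in\mathbb{Q}^p$ satisfies $h(x_1,\ldots,x_p)\leqslant b$.
   Context: For a positive integer $n$, let $G_n=\{x_i\cdot x_j=x_k : i,j,k\in\{1,\ldots,n\}\}\cup\{x_i+1=x_k : i,k\in\{1,\ldots,n\}\}$, a set of equations in the variables $x_1,\ldots,x_n$. Define $f(1)=1$ and $f(n+1)=2^{2^{f(n)}}$ for every positive integer $n$. Conjecture A: for every positive integer $n$, if a system $\mathcal{S}\subseteq G_n$ has only finitely many solutions in non-negative integers $x_1,\ldots,x_n$, then each such solution $(x_1,\ldots,x_n)$ satisfies $x_1,\ldots,x_n\leqslant f(2n)$. The height of a rational number $\frac{p}{q}$ written in lowest terms is $h\left(\frac{p}{q}\right)=\max(|p|,|q|)$; the height of a rational tuple is $h(x_1,\ldots,x_n)=\max(h(x_1),\ldots,h(x_n))$. A Diophantine equation is an equation $D(x_1,\ldots,x_p)=0$ with $p\geqslant 1$ and $D\in\mathbb{Z}[x_1,\ldots,x_p]$; the list of variables is part of the data. *)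

theory Defs
  imports Complex_Main "HOL-Library.FuncSet" "HOL-Library.Poly_Mapping" "HOL-Library.Nat_Bijection"
begin

section \<open>Algorithms\<close>

text \<open>
  An algorithm is a program for a partial recursive function in the sense of Kleene.
  \<open>recf_eval P xs y\<close> means that program \<open>P\<close> halts on input \<open>xs\<close> with output \<open>y\<close>.
  Arities are not recorded in the syntax: restricted to argument lists of any fixed length,
  the functions computed are exactly the partial recursive ones of that arity.
\<close>

datatype recf =
    Zero
  | Succ
  | Proj nat
  | Comp recf "recf list"
  | PrimRec recf recf
  | Mu recf

inductive recf_eval :: "recf \<Rightarrow> nat list \<Rightarrow> nat \<Rightarrow> bool" where
  Zero: "recf_eval Zero xs 0"
| Succ: "recf_eval Succ [x] (Suc x)"
| Proj: "i < length xs \<Longrightarrow> recf_eval (Proj i) xs (xs ! i)"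
| Comp: "list_all2 (\<lambda>Q y. recf_eval Q xs y) Qs ys \<Longrightarrow> recf_eval P ys z
    \<Longrightarrow> recf_eval (Comp P Qs) xs z"
| PrimRec_0: "recf_eval P xs y \<Longrightarrow> recf_eval (PrimRec P Q) (0 # xs) y"
| PrimRec_Suc: "recf_eval (PrimRec P Q) (n # xs) y \<Longrightarrow> recf_eval Q (n # y # xs) z
    \<Longrightarrow> recf_eval (PrimRec P Q) (Suc n # xs) z"
| Mu: "recf_eval P (n # xs) 0 \<Longrightarrow> \<forall>m<n. \<exists>y. recf_eval P (m # xs) (Suc y)
    \<Longrightarrow> recf_eval (Mu P) xs n"
  monos list_all2_mono

inductive_cases recf_eval_ZeroE: "recf_eval Zero xs y"
inductive_cases recf_eval_SuccE: "recf_eval Succ xs y"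
inductive_cases recf_eval_ProjE: "recf_eval (Proj i) xs y"
inductive_cases recf_eval_CompE: "recf_eval (Comp P Qs) xs y"
inductive_cases recf_eval_PrimRec_0E: "recf_eval (PrimRec P Q) (0 # xs) y"
inductive_cases recf_eval_PrimRec_SucE: "recf_eval (PrimRec P Q) (Suc n # xs) y"
inductive_cases recf_eval_MuE: "recf_eval (Mu P) xs y"

lemma recf_eval_deterministic:
  "recf_eval P xs y \<Longrightarrow> recf_eval P xs y' \<Longrightarrow> y = y'"
proof (induction arbitrary: y' rule: recf_eval.induct)
  case (Zero xs)
  then show ?case by (blast elim: recf_eval_ZeroE)
next
  case (Succ x)
  then show ?case by (blast elim: recf_eval_SuccE)
next
  case (Proj i xs)
  from Proj.prems show ?case by (rule recf_eval_ProjE) simp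
next
  case (Comp xs Qs ys P z)
  from Comp.prems obtain ys' where
    ys': "list_all2 (\<lambda>Q y. recf_eval Q xs y) Qs ys'" "recf_eval P ys' y'"
    by (rule recf_eval_CompE)
  have "ys = ys'"
  proof (rule nth_equalityI)
    show "length ys = length ys'"
      using list_all2_lengthD[OF Comp.IH(1)] list_all2_lengthD[OF ys'(1)] by simp
    show "ys ! i = ys' ! i" if "i < length ys" for i
    proof -
      have i: "i < length Qs" using that list_all2_lengthD[OF Comp.IH(1)] by simp
      show ?thesis
        using list_all2_nthD[OF Comp.IH(1) i] list_all2_nthD[OF ys'(1) i] by blast
    qed
  qed
  then show ?case using Comp.IH(2) ys'(2) by simp
next
  case (PrimRec_0 P xs y Q)
  from PrimRec_0.prems have "recf_eval P xs y'" by (rule recf_eval_PrimRec_0E)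
  then show ?case by (rule PrimRec_0.IH)
next
  case (PrimRec_Suc P Q n xs y z)
  from PrimRec_Suc.prems obtain w where
    w: "recf_eval (PrimRec P Q) (n # xs) w" "recf_eval Q (n # w # xs) y'"
    by (rule recf_eval_PrimRec_SucE)
  have "y = w" using w(1) by (rule PrimRec_Suc.IH(1))
  then show ?case using w(2) PrimRec_Suc.IH(2) by simp
next
  case (Mu P n xs)
  have y': "recf_eval P (y' # xs) 0" "\<forall>m<y'. \<exists>y. recf_eval P (m # xs) (Suc y)"
    using Mu.prems by (auto elim: recf_eval_MuE)
  show ?case
  proof (cases n y' rule: linorder_cases)
    case less
    then obtain y where "recf_eval P (n # xs) (Suc y)" using y'(2) by blast
    then have "0 = Suc y" by (rule Mu.IH(1))
    then show ?thesis by simp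
  next
    case greater
    then obtain y where "\<forall>w. recf_eval P (y' # xs) w \<longrightarrow> Suc y = w" using Mu.IH(2) by blast
    then have "Suc y = 0" using y'(1) by blast
    then show ?thesis by simp
  qed
qed

section \<open>Conjecture A\<close>

text \<open>\<open>Mult i j k\<close> is the equation $x_i \cdot x_j = x_k$ and \<open>Incr i k\<close> is $x_i + 1 = x_k$.\<close>

datatype equation = Mult nat nat nat | Incr nat nat

definition G :: "nat \<Rightarrow> equation set" where
  "G n = {Mult i j k | i j k. i \<in> {1..n} \<and> j \<in> {1..n} \<and> k \<in> {1..n}}
       \<union> {Incr i k | i k. i \<in> {1..n} \<and> k \<in> {1..n}}"

fun satisfies :: "(nat \<Rightarrow> nat) \<Rightarrow> equation \<Rightarrow> bool" where
  "satisfies x (Mult i j k) \<longleftrightarrow> x i * x j = x k"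
| "satisfies x (Incr i k) \<longleftrightarrow> x i + 1 = x k"

text \<open>
  An \<open>n\<close>-tuple is an element of \<open>{1..n} \<rightarrow>\<^sub>E UNIV\<close>, i.e. a function with a fixed value outside
  \<open>{1..n}\<close>; this is what makes finiteness of a set of functions mean finiteness of the set of tuples.
\<close>

definition nat_solutions :: "nat \<Rightarrow> equation set \<Rightarrow> (nat \<Rightarrow> nat) set" where
  "nat_solutions n S = {x \<in> {1..n} \<rightarrow>\<^sub>E UNIV. \<forall>e\<in>S. satisfies x e}"

text \<open>Only the values of \<open>tower\<close> at positive arguments matter; \<open>tower 0\<close> is a dummy value.\<close>

fun tower :: "nat \<Rightarrow> nat" where
  "tower 0 = 0"
| "tower (Suc 0) = 1"
| "tower (Suc (Suc n)) = 2 ^ (2 ^ tower (Suc n))"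

definition conjecture_A :: bool where
  "conjecture_A \<longleftrightarrow>
    (\<forall>n\<ge>1. \<forall>S\<subseteq>G n. finite (nat_solutions n S) \<longrightarrow>
      (\<forall>x\<in>nat_solutions n S. \<forall>i\<in>{1..n}. x i \<le> tower (2 * n)))"

section \<open>Diophantine equations over the rationals\<close>

text \<open>
  A polynomial maps each monomial to its coefficient, and a monomial maps each variable index to
  its exponent. \<open>int_polys p\<close> is $\mathbb{Z}[x_1,\ldots,x_p]$.
\<close>

type_synonym int_poly = "(nat \<Rightarrow>\<^sub>0 nat) \<Rightarrow>\<^sub>0 int"

definition int_polys :: "nat \<Rightarrow> int_poly set" where
  "int_polys p = {D. \<forall>m \<in> Poly_Mapping.keys D. Poly_Mapping.keys m \<subseteq> {1..p}}"

definition poly_value :: "nat \<Rightarrow> int_poly \<Rightarrow> (nat \<Rightarrow> rat) \<Rightarrow> rat" where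
  "poly_value p D x =
    (\<Sum>m\<in>Poly_Mapping.keys D. of_int (Poly_Mapping.lookup D m) *
      (\<Prod>i\<in>{1..p}. x i ^ Poly_Mapping.lookup m i))"

definition rat_solutions :: "nat \<Rightarrow> int_poly \<Rightarrow> (nat \<Rightarrow> rat) set" where
  "rat_solutions p D = {x \<in> {1..p} \<rightarrow>\<^sub>E UNIV. poly_value p D x = 0}"

definition height :: "rat \<Rightarrow> int" where
  "height r = (case quotient_of r of (a, b) \<Rightarrow> max \<bar>a\<bar> \<bar>b\<bar>)"

definition tuple_height :: "nat \<Rightarrow> (nat \<Rightarrow> rat) \<Rightarrow> int" where
  "tuple_height p x = Max ((\<lambda>i. height (x i)) ` {1..p})"

text \<open>
  The equation \<open>D = 0\<close> in the variables $x_1,\ldots,x_p$ is presented to an algorithm as the number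
  \<open>dioph_code p D\<close>, which codes \<open>p\<close> together with the finite list of the terms of \<open>D\<close>
  (exponent vector, nonzero coefficient), listed without repetition in a fixed order of the monomials.
\<close>

definition dioph_code :: "nat \<Rightarrow> int_poly \<Rightarrow> nat" where
  "dioph_code p D = prod_encode (p, list_encode (map
    (\<lambda>(m, c). prod_encode (list_encode (map (Poly_Mapping.lookup m) [1..<Suc p]), int_encode c))
    (Poly_Mapping.items D)))"

lemma dioph_code_inject:
  assumes "D \<in> int_polys p" "D' \<in> int_polys p'"
    and code: "dioph_code p D = dioph_code p' D'"
  shows "p = p' \<and> D = D'"
proof -
  let ?g = "\<lambda>(m, c). prod_encode (list_encode (map (Poly_Mapping.lookup m) [1..<Suc p]), int_encode c)"
  have p: "p = p'"
    and items: "map ?g (Poly_Mapping.items D) = map ?g (Poly_Mapping.items D')"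
    using code by (auto simp: dioph_code_def list_encode_eq)
  have keys: "Poly_Mapping.keys m \<subseteq> {1..p}"
    if "(m, c) \<in> set (Poly_Mapping.items D) \<union> set (Poly_Mapping.items D')" for m c
    using that assms(1,2) p by (auto simp: Poly_Mapping.items_def int_polys_def)
  have "inj_on ?g (set (Poly_Mapping.items D) \<union> set (Poly_Mapping.items D'))"
  proof (rule inj_onI, goal_cases)
    case (1 s t)
    obtain m c m' c' where st: "s = (m, c)" "t = (m', c')" by (cases s, cases t)
    note mc = 1(1)[unfolded st] 1(2)[unfolded st] and eq = 1(3)[unfolded st]
    have "Poly_Mapping.lookup m i = Poly_Mapping.lookup m' i" for i
    proof (cases "i \<in> {1..p}")
      case True
      then show ?thesis using eq by (auto simp: list_encode_eq)
    next
      case False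
      then have "i \<notin> Poly_Mapping.keys m" "i \<notin> Poly_Mapping.keys m'"
        using keys[OF mc(1)] keys[OF mc(2)] by blast+
      then show ?thesis by (simp add: in_keys_iff)
    qed
    then have "m = m'" by (rule poly_mapping_eqI)
    moreover have "c = c'" using eq by (simp add: int_encode_eq)
    ultimately show ?case using st by simp
  qed
  then have "Poly_Mapping.items D = Poly_Mapping.items D'"
    using items by (simp add: inj_on_map_eq_map)
  then have "Poly_Mapping.the_value (Poly_Mapping.items D) = Poly_Mapping.the_value (Poly_Mapping.items D')"
    by (rule arg_cong)
  then show ?thesis using p by simp
qed

end

theory Submission
  imports Defs
begin

text \<open>
  Conjecture A bounds the solutions of a system in terms of nothing but its number of unknowns.
  It therefore suffices to translate \<open>D = 0\<close> over the rationals into a system in the sense of the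
  conjecture, such that finitely many rational solutions give finitely many natural ones and the
  number of unknowns is bounded by a simple function of the code of \<open>D\<close>. The algorithm does not
  build the system, it only evaluates the bound; so very wasteful estimates are harmless, and a
  program made of composition and iteration of unary functions is enough.

  A rational number is written as \<open>\<sigma> * a / c\<close> with a sign \<open>\<sigma>\<close> and coprime \<open>a\<close>, \<open>c\<close>. The signs are not
  unknowns: the system is built for the sign pattern of the solution whose height is to be bounded.
  Without coprimality every rational solution would come from infinitely many tuples. It is
  expressed by \<open>c = u + w + 1\<close> and \<open>v * c = u * a + 1\<close>: such numbers exist exactly for coprime
  \<open>a\<close>, \<open>c\<close>, and because \<open>u < c\<close> they are unique (\<open>bezout_witness\<close>, \<open>bezout_witness_coprime\<close>,
  \<open>bezout_witness_unique\<close>). Clearing denominators and moving the terms with a negative coefficient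
  to the other side turns \<open>D = 0\<close> into an equation between polynomials with coefficients in the
  natural numbers (\<open>encoded_equation_iff\<close>).

  Polynomials are broken up into the two permitted kinds of equation by naming all intermediate
  results. Each new unknown is determined by the earlier ones, so the solution set of the system is
  in bijection with the set that is being described, and \<open>conjecture_A_bound\<close> applies to any relation
  between polynomials. Addition is not among the permitted equations; \<open>sum_via_products\<close>
  expresses it by products and successors. Counting the intermediate results for a polynomial whose
  data are all at most \<open>K\<close> gives at most \<open>2 ^ (4 * K + 8)\<close> unknowns, and the code of an equation is
  such a \<open>K\<close> (\<open>dioph_code_bounds\<close>).
\<close>

section \<open>Programs for iterated functions\<close>

definition unary_recursive :: "(nat \<Rightarrow> nat) \<Rightarrow> bool" where
  "unary_recursive f \<longleftrightarrow> (\<exists>P. \<forall>x. recf_eval P [x] (f x))"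

lemma unary_recursive_Suc: "unary_recursive Suc"
  unfolding unary_recursive_def using recf_eval.Succ by blast

lemma unary_recursive_comp:
  assumes "unary_recursive f" "unary_recursive g"
  shows "unary_recursive (\<lambda>x. f (g x))"
proof -
  from assms obtain P Q where P: "\<And>x. recf_eval P [x] (f x)" and Q: "\<And>x. recf_eval Q [x] (g x)"
    unfolding unary_recursive_def by blast
  have "recf_eval (Comp P [Q]) [x] (f (g x))" for x
    by (rule recf_eval.Comp[where ys = "[g x]"]) (auto simp: P Q)
  then show ?thesis unfolding unary_recursive_def by blast
qed

lemma constant_program: "\<exists>P. \<forall>xs. recf_eval P xs c"
proof (induction c)
  case 0
  show ?case using recf_eval.Zero by blast
next
  case (Suc c)
  then obtain P where P: "\<And>xs. recf_eval P xs c" by blast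
  have "recf_eval (Comp Succ [P]) xs (Suc c)" for xs
    by (rule recf_eval.Comp[where ys = "[c]"]) (auto simp: P recf_eval.Succ)
  then show ?case by blast
qed

lemma unary_recursive_iterate:
  assumes "unary_recursive h"
  shows "unary_recursive (\<lambda>n. (h ^^ n) c)"
proof -
  from assms obtain P where P: "\<And>x. recf_eval P [x] (h x)"
    unfolding unary_recursive_def by blast
  obtain C where C: "\<And>xs. recf_eval C xs c" using constant_program by blast
  let ?Q = "Comp P [Proj 1]"
  have proj: "recf_eval (Proj 1) [n, y] y" for n y
    using recf_eval.Proj[of 1 "[n, y]"] by simp
  have Q: "recf_eval ?Q [n, y] (h y)" for n y
    by (rule recf_eval.Comp[where ys = "[y]"]) (use proj P in auto)
  have "recf_eval (PrimRec C ?Q) [n] ((h ^^ n) c)" for n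
  proof (induction n)
    case 0
    show ?case using recf_eval.PrimRec_0[OF C, of ?Q "[]"] by simp
  next
    case (Suc n)
    show ?case using recf_eval.PrimRec_Suc[OF Suc Q] by simp
  qed
  then show ?thesis unfolding unary_recursive_def by blast
qed

lemma unary_recursive_double: "unary_recursive (\<lambda>n. 2 * n)"
proof -
  have "((\<lambda>y. Suc (Suc y)) ^^ n) 0 = 2 * n" for n by (induction n) auto
  moreover have "unary_recursive (\<lambda>n. ((\<lambda>y. Suc (Suc y)) ^^ n) 0)"
    by (intro unary_recursive_iterate unary_recursive_comp[OF unary_recursive_Suc]
        unary_recursive_Suc)
  ultimately show ?thesis by simp
qed

lemma unary_recursive_power_of_two: "unary_recursive (\<lambda>n. 2 ^ n)"
proof -
  have "((\<lambda>y. 2 * y) ^^ n) 1 = (2::nat) ^ n" for n by (induction n) auto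
  then show ?thesis
    using unary_recursive_iterate[OF unary_recursive_double, of 1] by simp
qed

text \<open>
  The iteration starts from \<open>tower 1 = 1\<close>, where the recursion \<open>y \<mapsto> 2 ^ 2 ^ y\<close> sets in; this is
  the reason for the shift of the argument.
\<close>

lemma unary_recursive_tower: "unary_recursive (\<lambda>n. tower (Suc n))"
proof -
  have "((\<lambda>y. 2 ^ 2 ^ y) ^^ n) 1 = tower (Suc n)" for n by (induction n) auto
  moreover have "unary_recursive (\<lambda>n. ((\<lambda>y. 2 ^ 2 ^ y) ^^ n) 1)"
    by (intro unary_recursive_iterate
        unary_recursive_comp[of "\<lambda>n. 2 ^ n", OF unary_recursive_power_of_two
          unary_recursive_power_of_two])
  ultimately show ?thesis by simp
qed

lemma tower_mono: "m \<le> n \<Longrightarrow> tower m \<le> tower n"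
proof (rule lift_Suc_mono_le[of tower])
  show "tower n \<le> tower (Suc n)" for n
  proof (cases n)
    case (Suc k)
    have "tower (Suc k) < 2 ^ tower (Suc k)" by (rule less_exp)
    also have "\<dots> < 2 ^ 2 ^ tower (Suc k)" by (rule less_exp)
    finally show ?thesis using Suc by simp
  qed simp
qed

section \<open>Systems that introduce uniquely determined unknowns\<close>

definition agree :: "nat \<Rightarrow> (nat \<Rightarrow> nat) \<Rightarrow> (nat \<Rightarrow> nat) \<Rightarrow> bool" where
  "agree n x y \<longleftrightarrow> (\<forall>i\<in>{1..n}. x i = y i)"

definition solves :: "(nat \<Rightarrow> nat) \<Rightarrow> equation set \<Rightarrow> bool" where
  "solves x S \<longleftrightarrow> (\<forall>e\<in>S. satisfies x e)"

text \<open>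
  The system \<open>S\<close> describes the relation \<open>R\<close> in the first \<open>n\<close> unknowns, and the unknowns from
  \<open>n + 1\<close> to \<open>n'\<close> are functions of these: the last two conjuncts are existence and
  uniqueness. Assignments are total functions, of which only the values up to \<open>n'\<close> matter.
\<close>

definition unique_extension :: "nat \<Rightarrow> nat \<Rightarrow> equation set \<Rightarrow> ((nat \<Rightarrow> nat) \<Rightarrow> bool) \<Rightarrow> bool" where
  "unique_extension n n' S R \<longleftrightarrow> n \<le> n' \<and> S \<subseteq> G n' \<and>
    (\<forall>x. solves x S \<longrightarrow> R x) \<and>
    (\<forall>x. R x \<longrightarrow> (\<exists>y. agree n x y \<and> solves y S)) \<and>
    (\<forall>x y. solves x S \<longrightarrow> solves y S \<longrightarrow> agree n x y \<longrightarrow> agree n' x y)"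

lemma agree_refl: "agree n x x" by (simp add: agree_def)

lemma agree_sym: "agree n x y \<Longrightarrow> agree n y x" by (simp add: agree_def)

lemma agree_trans: "agree n x y \<Longrightarrow> agree n y z \<Longrightarrow> agree n x z" by (simp add: agree_def)

lemma agree_mono: "agree n x y \<Longrightarrow> m \<le> n \<Longrightarrow> agree m x y" by (simp add: agree_def)

lemma in_G_iff:
  "Mult i j k \<in> G n \<longleftrightarrow> i \<in> {1..n} \<and> j \<in> {1..n} \<and> k \<in> {1..n}"
  "Incr i k \<in> G n \<longleftrightarrow> i \<in> {1..n} \<and> k \<in> {1..n}"
  by (auto simp: G_def)

lemma G_mono: "m \<le> n \<Longrightarrow> G m \<subseteq> G n"
  by (fastforce simp: G_def)

lemma solves_Un: "solves x (S \<union> T) \<longleftrightarrow> solves x S \<and> solves x T"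
  by (auto simp: solves_def)

lemma solves_cong:
  assumes "S \<subseteq> G n" "agree n x y"
  shows "solves x S \<longleftrightarrow> solves y S"
proof -
  have "satisfies x e \<longleftrightarrow> satisfies y e" if "e \<in> S" for e
  proof -
    have "e \<in> G n" using that assms(1) by blast
    then show ?thesis using assms(2) by (auto simp: G_def agree_def)
  qed
  then show ?thesis by (auto simp: solves_def)
qed

text \<open>
  The relation \<open>R2\<close> has to be insensitive to the unknowns that \<open>S1\<close> introduces: they are chosen
  first, and \<open>R2\<close> must survive that choice before \<open>S2\<close> can be solved.
\<close>

lemma unique_extension_compose:
  assumes 1: "unique_extension n n1 S1 R1" and 2: "unique_extension n1 n2 S2 R2"
    and R2: "\<And>x y. agree n x y \<Longrightarrow> R2 x \<Longrightarrow> R2 y"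
  shows "unique_extension n n2 (S1 \<union> S2) (\<lambda>x. R1 x \<and> R2 x)"
proof -
  have le: "n \<le> n1" "n1 \<le> n2" and sub: "S1 \<subseteq> G n1" "S2 \<subseteq> G n2"
    using 1 2 by (simp_all add: unique_extension_def)
  show ?thesis
    unfolding unique_extension_def
  proof (intro conjI allI impI)
    show "n \<le> n2" using le by simp
    show "S1 \<union> S2 \<subseteq> G n2" using sub G_mono[OF le(2)] by blast
    fix x
    show "R1 x" if "solves x (S1 \<union> S2)"
      using that 1 by (simp add: solves_Un unique_extension_def)
    show "R2 x" if "solves x (S1 \<union> S2)"
      using that 2 by (simp add: solves_Un unique_extension_def)
    show "\<exists>y. agree n x y \<and> solves y (S1 \<union> S2)" if R: "R1 x \<and> R2 x"
    proof -
      obtain y where y: "agree n x y" "solves y S1"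
        using 1 R unfolding unique_extension_def by metis
      then have "R2 y" using R2 R by blast
      then obtain z where z: "agree n1 y z" "solves z S2"
        using 2 unfolding unique_extension_def by metis
      have "solves z S1" using solves_cong[OF sub(1) z(1)] y(2) by simp
      then show ?thesis
        using z(2) agree_trans[OF y(1) agree_mono[OF z(1) le(1)]] by (auto simp: solves_Un)
    qed
    fix y
    show "agree n2 x y"
      if s: "solves x (S1 \<union> S2)" "solves y (S1 \<union> S2)" and ag: "agree n x y"
    proof -
      have "solves x S1" "solves y S1" and s2: "solves x S2" "solves y S2"
        using s by (simp_all add: solves_Un)
      then have "agree n1 x y" using 1 ag by (simp add: unique_extension_def)
      then show ?thesis using 2 s2 by (simp add: unique_extension_def)
    qed
  qed
qed

lemma unique_extension_mult:
  assumes "i \<in> {1..n}" "j \<in> {1..n}"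
  shows "unique_extension n (n + 1) {Mult i j (n + 1)} (\<lambda>_. True)"
  unfolding unique_extension_def
proof (intro conjI allI impI)
  show "{Mult i j (n + 1)} \<subseteq> G (n + 1)" using assms by (auto simp: G_def)
  show "\<exists>y. agree n x y \<and> solves y {Mult i j (n + 1)}" for x
    using assms by (intro exI[of _ "x(n + 1 := x i * x j)"]) (auto simp: agree_def solves_def)
  show "agree (n + 1) x y" if "solves x {Mult i j (n + 1)}" "solves y {Mult i j (n + 1)}"
    "agree n x y" for x y
  proof -
    have "x i = y i" "x j = y j" using that(3) assms by (auto simp: agree_def)
    then have "x (Suc n) = y (Suc n)" using that(1,2) by (simp add: solves_def)
    then show ?thesis using that(3) by (auto simp: agree_def le_Suc_eq)
  qed
qed auto

text \<open>
  Constants have to be produced by equations, too. A successor that is idempotent can only be \<open>1\<close>.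
\<close>

lemma solves_one_system:
  assumes "solves x {Incr m n, Mult n n n}"
  shows "x m = 0" "x n = 1"
proof -
  have "x m + 1 = x n" "x n * x n = x n" using assms by (auto simp: solves_def)
  then show "x m = 0" "x n = 1" by auto
qed

lemma unique_extension_one:
  "unique_extension n (n + 2) {Incr (n + 1) (n + 2), Mult (n + 2) (n + 2) (n + 2)} (\<lambda>_. True)"
  (is "unique_extension n _ ?S _")
  unfolding unique_extension_def
proof (intro conjI allI impI)
  show "?S \<subseteq> G (n + 2)" by (auto simp: G_def)
  show "\<exists>y. agree n x y \<and> solves y ?S" for x
    by (intro exI[of _ "x(n + 1 := 0, n + 2 := 1)"]) (auto simp: agree_def solves_def)
  show "agree (n + 2) x y" if "solves x ?S" "solves y ?S" "agree n x y" for x y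
    using solves_one_system[OF that(1)] solves_one_system[OF that(2)] that(3)
    by (auto simp: agree_def le_Suc_eq)
qed auto

text \<open>
  With \<open>w = z + 1\<close> and \<open>c = b + 1\<close> the two sides differ by \<open>w * (a + c) - w * w\<close>, so they agree iff
  \<open>w = 0\<close> or \<open>w = a + c\<close>. Passing to the successors excludes \<open>w = 0\<close>, where the identity would say
  nothing about \<open>a\<close> and \<open>c\<close>.
\<close>

lemma sum_via_products:
  fixes a b z :: nat
  shows "((z + 1) * a + 1) * ((z + 1) * (b + 1) + 1) = (z + 1) * (z + 1) * (a * (b + 1) + 1) + 1
    \<longleftrightarrow> z = a + b"
proof -
  have expand: "(w * a + 1) * (w * c + 1) = w * w * (a * c) + w * (a + c) + 1"
    "w * w * (a * c + 1) + 1 = w * w * (a * c) + w * w + 1" for w c :: nat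
    by (simp_all add: algebra_simps)
  have "(w * a + 1) * (w * c + 1) = w * w * (a * c + 1) + 1 \<longleftrightarrow> w * (a + c) = w * w"
    for w c :: nat
    unfolding expand by (simp only: add_right_cancel add_left_cancel)
  also have "(z + 1) * (a + (b + 1)) = (z + 1) * (z + 1) \<longleftrightarrow> z = a + b"
    unfolding mult_cancel1 by auto
  finally show ?thesis .
qed

text \<open>
  Unknown \<open>n + 1\<close> is the sum. No equation computes it from \<open>i\<close> and \<open>j\<close>; it is guessed, the
  unknowns \<open>n + 2\<close> to \<open>n + 12\<close> evaluate both sides of \<open>sum_via_products\<close>, and the last equation,
  which equates the sides, forces the guess to be right.
\<close>

definition addition_system :: "nat \<Rightarrow> nat \<Rightarrow> nat \<Rightarrow> equation set" where
  "addition_system n i j =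
    {Incr j (n + 2), Incr (n + 1) (n + 3), Mult (n + 3) i (n + 4), Incr (n + 4) (n + 5),
     Mult (n + 3) (n + 2) (n + 6), Incr (n + 6) (n + 7), Mult (n + 5) (n + 7) (n + 8),
     Mult i (n + 2) (n + 9), Incr (n + 9) (n + 10), Mult (n + 3) (n + 3) (n + 11),
     Mult (n + 11) (n + 10) (n + 12), Incr (n + 12) (n + 8)}"

lemma solves_addition_system:
  "solves x (addition_system n i j) \<longleftrightarrow> (let a = x i; b = x j; z = a + b in
     x (n + 1) = z \<and> x (n + 2) = b + 1 \<and> x (n + 3) = z + 1 \<and>
     x (n + 4) = (z + 1) * a \<and> x (n + 5) = (z + 1) * a + 1 \<and>
     x (n + 6) = (z + 1) * (b + 1) \<and> x (n + 7) = (z + 1) * (b + 1) + 1 \<and>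
     x (n + 8) = ((z + 1) * a + 1) * ((z + 1) * (b + 1) + 1) \<and>
     x (n + 9) = a * (b + 1) \<and> x (n + 10) = a * (b + 1) + 1 \<and>
     x (n + 11) = (z + 1) * (z + 1) \<and>
     x (n + 12) = (z + 1) * (z + 1) * (a * (b + 1) + 1))" (is "?L \<longleftrightarrow> ?R")
proof -
  note id = sum_via_products[of "x (n + 1)" "x i" "x j"]
  show ?thesis
  proof
    assume ?L
    then have e: "x (n + 2) = x j + 1" "x (n + 3) = x (n + 1) + 1" "x (n + 4) = x (n + 3) * x i"
      "x (n + 5) = x (n + 4) + 1" "x (n + 6) = x (n + 3) * x (n + 2)" "x (n + 7) = x (n + 6) + 1"
      "x (n + 8) = x (n + 5) * x (n + 7)" "x (n + 9) = x i * x (n + 2)"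
      "x (n + 10) = x (n + 9) + 1" "x (n + 11) = x (n + 3) * x (n + 3)"
      "x (n + 12) = x (n + 11) * x (n + 10)" and last: "x (n + 8) = x (n + 12) + 1"
      unfolding addition_system_def solves_def by (simp_all only: ball_simps satisfies.simps simp_thms)
    have z: "x (n + 1) = x i + x j" using last unfolding e by (rule iffD1[OF id])
    show ?R unfolding Let_def e z by (intro conjI refl)
  next
    assume ?R
    then have e: "x (n + 1) = x i + x j" "x (n + 2) = x j + 1" "x (n + 3) = x (n + 1) + 1"
      "x (n + 4) = x (n + 3) * x i"
      "x (n + 5) = x (n + 4) + 1" "x (n + 6) = x (n + 3) * x (n + 2)" "x (n + 7) = x (n + 6) + 1"
      "x (n + 8) = x (n + 5) * x (n + 7)" "x (n + 9) = x i * x (n + 2)"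
      "x (n + 10) = x (n + 9) + 1" "x (n + 11) = x (n + 3) * x (n + 3)"
      "x (n + 12) = x (n + 11) * x (n + 10)"
      by (simp_all only: Let_def)
    have last: "x (n + 8) = x (n + 12) + 1" unfolding e(2-) by (rule iffD2[OF id e(1)])
    show ?L
      by (simp only: addition_system_def solves_def ball_simps satisfies.simps)
        (intro conjI TrueI; rule e[symmetric] last[symmetric])
  qed
qed

lemma unique_extension_add:
  assumes "i \<in> {1..n}" "j \<in> {1..n}"
  shows "unique_extension n (n + 12) (addition_system n i j) (\<lambda>_. True)"
  unfolding unique_extension_def
proof (intro conjI allI impI)
  show "addition_system n i j \<subseteq> G (n + 12)"
    using assms by (simp add: in_G_iff addition_system_def)
  fix x :: "nat \<Rightarrow> nat"
  define a b z where "a = x i" "b = x j" "z = x i + x j"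
  \<comment> \<open>The value of unknown \<open>n + l\<close> is entry \<open>l\<close>; entry \<open>0\<close> is never read.\<close>
  define v where "v = [0, z, b + 1, z + 1, (z + 1) * a, (z + 1) * a + 1,
     (z + 1) * (b + 1), (z + 1) * (b + 1) + 1,
     ((z + 1) * a + 1) * ((z + 1) * (b + 1) + 1),
     a * (b + 1), a * (b + 1) + 1, (z + 1) * (z + 1),
     (z + 1) * (z + 1) * (a * (b + 1) + 1)]"
  define y where "y l = (if l \<le> n then x l else v ! (l - n))" for l
  have old: "y i = a" "y j = b" "a + b = z"
    using assms by (simp_all add: y_def a_b_z_def)
  have fresh: "y (n + l) = v ! l" if "0 < l" for l using that by (simp add: y_def)
  have vals: "v ! 1 = z" "v ! 2 = b + 1" "v ! 3 = z + 1" "v ! 4 = (z + 1) * a"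
    "v ! 5 = (z + 1) * a + 1" "v ! 6 = (z + 1) * (b + 1)" "v ! 7 = (z + 1) * (b + 1) + 1"
    "v ! 8 = ((z + 1) * a + 1) * ((z + 1) * (b + 1) + 1)"
    "v ! 9 = a * (b + 1)" "v ! 10 = a * (b + 1) + 1" "v ! 11 = (z + 1) * (z + 1)"
    "v ! 12 = (z + 1) * (z + 1) * (a * (b + 1) + 1)"
    unfolding v_def by simp_all
  have "solves y (addition_system n i j)"
    unfolding solves_addition_system Let_def old
    by (intro conjI; subst fresh; simp only: vals zero_less_numeral zero_less_one)
  moreover have "agree n x y" by (simp add: agree_def y_def)
  ultimately show "\<exists>y. agree n x y \<and> solves y (addition_system n i j)" by blast
next
  fix x y
  assume s: "solves x (addition_system n i j)" "solves y (addition_system n i j)" and ag: "agree n x y"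
  have ij: "x i = y i" "x j = y j" using ag assms by (auto simp: agree_def)
  have fresh: "x (n + l) = y (n + l)" if "l \<in> {1,2,3,4,5,6,7,8,9,10,11,12}" for l
    using that
    by (elim insertE emptyE; simp only: s[unfolded solves_addition_system Let_def] ij)
  show "agree (n + 12) x y" unfolding agree_def
  proof
    fix l assume l: "l \<in> {1..n + 12}"
    show "x l = y l"
    proof (cases "l \<le> n")
      case True then show ?thesis using ag l by (auto simp: agree_def)
    next
      case False
      then obtain r where r: "l = n + r" "1 \<le> r" "r \<le> 12"
        using l by (intro that[of "l - n"]) auto
      then have "r \<in> {1,2,3,4,5,6,7,8,9,10,11,12}"
        by (simp only: insert_iff empty_iff) presburger
      then show ?thesis using fresh r(1) by simp
    qed
  qed
qed auto

section \<open>Polynomial functions and relations at a bounded number of new unknowns\<close>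

definition local_at :: "nat \<Rightarrow> ((nat \<Rightarrow> nat) \<Rightarrow> 'a) \<Rightarrow> bool" where
  "local_at k f \<longleftrightarrow> (\<forall>x y. agree k x y \<longrightarrow> f x = f y)"

text \<open>
  In the next two definitions \<open>s\<close> bounds the number of new unknowns. The system is required for
  every \<open>n \<ge> k\<close> because subterms are translated one after the other: the unknowns that follow the
  first \<open>k\<close> may already be in use.
\<close>

definition computed :: "nat \<Rightarrow> nat \<Rightarrow> ((nat \<Rightarrow> nat) \<Rightarrow> nat) \<Rightarrow> bool" where
  "computed k s f \<longleftrightarrow> local_at k f \<and> (\<forall>n\<ge>k. \<exists>n' S j. n' \<le> n + s \<and> j \<in> {1..n'} \<and>
     unique_extension n n' S (\<lambda>_. True) \<and> (\<forall>x. solves x S \<longrightarrow> x j = f x))"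

definition expressible :: "nat \<Rightarrow> nat \<Rightarrow> ((nat \<Rightarrow> nat) \<Rightarrow> bool) \<Rightarrow> bool" where
  "expressible k s R \<longleftrightarrow> local_at k R \<and>
     (\<forall>n\<ge>k. \<exists>n' S. n' \<le> n + s \<and> unique_extension n n' S R)"

lemma computed_mono: "computed k s f \<Longrightarrow> s \<le> t \<Longrightarrow> computed k t f"
  unfolding computed_def using order_trans[OF _ add_left_mono] by blast

lemma expressible_mono: "expressible k s R \<Longrightarrow> s \<le> t \<Longrightarrow> expressible k t R"
  unfolding expressible_def using order_trans[OF _ add_left_mono] by blast

lemma computed_coordinate:
  assumes "i \<in> {1..k}"
  shows "computed k 0 (\<lambda>x. x i)"
  unfolding computed_def
proof (intro conjI allI impI)
  show "local_at k (\<lambda>x. x i)" using assms by (auto simp: local_at_def agree_def)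
  fix n assume "k \<le> n"
  then show "\<exists>n' S j. n' \<le> n + 0 \<and> j \<in> {1..n'} \<and> unique_extension n n' S (\<lambda>_. True) \<and>
      (\<forall>x. solves x S \<longrightarrow> x j = x i)"
    using assms
    by (intro exI[of _ n] exI[of _ "{}"] exI[of _ i])
      (auto simp: unique_extension_def solves_def intro: agree_refl)
qed

lemma computed_bit:
  assumes "c \<le> 1"
  shows "computed k 2 (\<lambda>_. c)"
  unfolding computed_def
proof (intro conjI allI impI)
  fix n
  let ?S = "{Incr (n + 1) (n + 2), Mult (n + 2) (n + 2) (n + 2)}"
  have "x (n + 1 + c) = c" if "solves x ?S" for x
    using solves_one_system[OF that] assms by (cases c) auto
  then show "\<exists>n' S j. n' \<le> n + 2 \<and> j \<in> {1..n'} \<and> unique_extension n n' S (\<lambda>_. True) \<and>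
      (\<forall>x. solves x S \<longrightarrow> x j = c)"
    using unique_extension_one[of n] assms
    by (intro exI[of _ "n + 2"] exI[of _ ?S] exI[of _ "n + 1 + c"]) auto
qed (simp add: local_at_def)

lemma computed_binary:
  assumes f: "computed k s f" and g: "computed k t g"
    and gadget: "\<And>n i j. i \<in> {1..n} \<Longrightarrow> j \<in> {1..n} \<Longrightarrow>
      \<exists>S. \<exists>l\<in>{1..n + c}. unique_extension n (n + c) S (\<lambda>_. True) \<and>
        (\<forall>x. solves x S \<longrightarrow> x l = h (x i) (x j))"
  shows "computed k (s + t + c) (\<lambda>x. h (f x) (g x))"
  unfolding computed_def
proof (intro conjI allI impI)
  show "local_at k (\<lambda>x. h (f x) (g x))"
    using f g unfolding computed_def local_at_def by metis
  fix n assume n: "k \<le> n"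
  obtain n1 S1 i where 1: "n1 \<le> n + s" "i \<in> {1..n1}" "unique_extension n n1 S1 (\<lambda>_. True)"
    "\<And>x. solves x S1 \<Longrightarrow> x i = f x" using f n unfolding computed_def by blast
  then have n1: "k \<le> n1" using n by (auto simp: unique_extension_def)
  obtain n2 S2 j where 2: "n2 \<le> n1 + t" "j \<in> {1..n2}" "unique_extension n1 n2 S2 (\<lambda>_. True)"
    "\<And>x. solves x S2 \<Longrightarrow> x j = g x" using g n1 unfolding computed_def by blast
  have i: "i \<in> {1..n2}" using 1(2) 2(3) by (auto simp: unique_extension_def)
  obtain S3 l where 3: "l \<in> {1..n2 + c}" "unique_extension n2 (n2 + c) S3 (\<lambda>_. True)"
    "\<And>x. solves x S3 \<Longrightarrow> x l = h (x i) (x j)" using gadget[OF i 2(2)] by blast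
  have "unique_extension n (n2 + c) (S1 \<union> S2 \<union> S3) (\<lambda>_. True)"
    using unique_extension_compose[OF unique_extension_compose[OF 1(3) 2(3)] 3(2)] by simp
  moreover have "x l = h (f x) (g x)" if "solves x (S1 \<union> S2 \<union> S3)" for x
    using that 1(4) 2(4) 3(3) by (simp add: solves_Un)
  moreover have "n2 + c \<le> n + (s + t + c)" using 1(1) 2(1) by simp
  ultimately show "\<exists>n' S j. n' \<le> n + (s + t + c) \<and> j \<in> {1..n'} \<and>
      unique_extension n n' S (\<lambda>_. True) \<and> (\<forall>x. solves x S \<longrightarrow> x j = h (f x) (g x))"
    using 3(1) by blast
qed

lemma computed_mult:
  assumes "computed k s f" "computed k t g"
  shows "computed k (s + t + 1) (\<lambda>x. f x * g x)"
  using assms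
proof (rule computed_binary)
  fix n i j :: nat assume "i \<in> {1..n}" "j \<in> {1..n}"
  from unique_extension_mult[OF this]
  show "\<exists>S. \<exists>l\<in>{1..n + 1}. unique_extension n (n + 1) S (\<lambda>_. True) \<and>
        (\<forall>x. solves x S \<longrightarrow> x l = x i * x j)"
    by (intro exI[of _ "{Mult i j (n + 1)}"] bexI[of _ "n + 1"]) (auto simp: solves_def)
qed

lemma computed_add:
  assumes "computed k s f" "computed k t g"
  shows "computed k (s + t + 12) (\<lambda>x. f x + g x)"
  using assms
proof (rule computed_binary)
  fix n i j :: nat assume "i \<in> {1..n}" "j \<in> {1..n}"
  from unique_extension_add[OF this]
  show "\<exists>S. \<exists>l\<in>{1..n + 12}. unique_extension n (n + 12) S (\<lambda>_. True) \<and>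
        (\<forall>x. solves x S \<longrightarrow> x l = x i + x j)"
    by (intro exI[of _ "addition_system n i j"] bexI[of _ "n + 1"])
      (auto simp: solves_addition_system Let_def)
qed

lemma computed_sum:
  assumes "finite A" "\<And>a. a \<in> A \<Longrightarrow> computed k s (f a)"
  shows "computed k (card A * (s + 12) + 2) (\<lambda>x. \<Sum>a\<in>A. f a x)"
  using assms
proof (induction A)
  case empty
  then show ?case using computed_bit[of 0 k] by (simp add: numeral_2_eq_2)
next
  case (insert a A)
  have "computed k (s + (card A * (s + 12) + 2) + 12) (\<lambda>x. f a x + (\<Sum>a\<in>A. f a x))"
    by (intro computed_add insert.IH) (use insert.prems in auto)
  then show ?case using insert.hyps by (simp add: algebra_simps)
qed

lemma computed_prod:
  assumes "finite A" "\<And>a. a \<in> A \<Longrightarrow> computed k s (f a)"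
  shows "computed k (card A * (s + 1) + 2) (\<lambda>x. \<Prod>a\<in>A. f a x)"
  using assms
proof (induction A)
  case empty
  then show ?case using computed_bit[of 1 k] by (simp add: numeral_2_eq_2)
next
  case (insert a A)
  have "computed k (s + (card A * (s + 1) + 2) + 1) (\<lambda>x. f a x * (\<Prod>a\<in>A. f a x))"
    by (intro computed_mult insert.IH) (use insert.prems in auto)
  then show ?case using insert.hyps by (simp add: algebra_simps)
qed

lemma computed_power: "computed k s f \<Longrightarrow> computed k (m * (s + 1) + 2) (\<lambda>x. f x ^ m)"
  using computed_prod[of "{..<m}" k s "\<lambda>_. f"] by simp

lemma computed_const: "computed k (14 * c + 2) (\<lambda>_. c)"
  using computed_sum[of "{..<c}" k 2 "\<lambda>_ _. 1"] computed_bit[of 1 k] by (simp add: mult.commute)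

text \<open>
  Two results are equated by giving them a common successor; this is the one place where a
  system restricts the given unknowns instead of merely extending them.
\<close>

lemma expressible_eq:
  assumes f: "computed k s f" and g: "computed k t g"
  shows "expressible k (s + t + 1) (\<lambda>x. f x = g x)"
  unfolding expressible_def
proof (intro conjI allI impI)
  show loc: "local_at k (\<lambda>x. f x = g x)"
    using f g unfolding computed_def local_at_def by metis
  fix n assume n: "k \<le> n"
  obtain n1 S1 i where 1: "n1 \<le> n + s" "i \<in> {1..n1}" "unique_extension n n1 S1 (\<lambda>_. True)"
    "\<And>x. solves x S1 \<Longrightarrow> x i = f x" using f n unfolding computed_def by blast
  then have n1: "k \<le> n1" using n by (auto simp: unique_extension_def)
  obtain n2 S2 j where 2: "n2 \<le> n1 + t" "j \<in> {1..n2}" "unique_extension n1 n2 S2 (\<lambda>_. True)"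
    "\<And>x. solves x S2 \<Longrightarrow> x j = g x" using g n1 unfolding computed_def by blast
  have i: "i \<in> {1..n2}" using 1(2) 2(3) by (auto simp: unique_extension_def)
  let ?S = "{Incr i (n2 + 1), Incr j (n2 + 1)}"
  have 12: "unique_extension n n2 (S1 \<union> S2) (\<lambda>_. True)"
    using unique_extension_compose[OF 1(3) 2(3)] by simp
  have 3: "unique_extension n2 (n2 + 1) ?S (\<lambda>x. x i = x j)"
    unfolding unique_extension_def
  proof (intro conjI allI impI)
    show "?S \<subseteq> G (n2 + 1)" using i 2(2) by (auto simp: G_def)
    show "\<exists>y. agree n2 x y \<and> solves y ?S" if "x i = x j" for x
      using that i 2(2)
      by (intro exI[of _ "x(n2 + 1 := x i + 1)"]) (auto simp: agree_def solves_def)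
    show "agree (n2 + 1) x y" if "solves x ?S" "solves y ?S" "agree n2 x y" for x y
    proof -
      have "x (n2 + 1) = x i + 1" "y (n2 + 1) = y i + 1" "x i = y i"
        using that i by (auto simp: solves_def agree_def)
      then show ?thesis using that(3) by (auto simp: agree_def le_Suc_eq)
    qed
  qed (auto simp: solves_def)
  have sub: "S1 \<union> S2 \<subseteq> G n2" "n \<le> n2" using 12 by (auto simp: unique_extension_def)
  have "unique_extension n (n2 + 1) (S1 \<union> S2 \<union> ?S) (\<lambda>x. f x = g x)"
    unfolding unique_extension_def
  proof (intro conjI allI impI)
    fix x
    show "f x = g x" if "solves x (S1 \<union> S2 \<union> ?S)"
    proof -
      have s: "solves x S1" "solves x S2" "solves x ?S" using that by (simp_all only: solves_Un)
      from s(3) have "x i = x j" by (simp add: solves_def)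
      then show ?thesis using 1(4)[OF s(1)] 2(4)[OF s(2)] by simp
    qed
    show "\<exists>y. agree n x y \<and> solves y (S1 \<union> S2 \<union> ?S)" if eq: "f x = g x"
    proof -
      obtain y where y: "agree n x y" "solves y (S1 \<union> S2)"
        using 12 unfolding unique_extension_def by metis
      then have "f y = g y" using loc n eq agree_mono unfolding local_at_def by blast
      then have "y i = y j" using y(2) 1(4) 2(4) by (simp add: solves_Un)
      then obtain z where z: "agree n2 y z" "solves z ?S"
        using 3 unfolding unique_extension_def by blast
      have "solves z (S1 \<union> S2)" using solves_cong[OF sub(1) z(1)] y(2) by simp
      then show ?thesis using z(2) agree_trans[OF y(1) agree_mono[OF z(1) sub(2)]]
        by (auto simp only: solves_Un)
    qed
    fix y
    show "agree (n2 + 1) x y"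
      if s: "solves x (S1 \<union> S2 \<union> ?S)" "solves y (S1 \<union> S2 \<union> ?S)" and ag: "agree n x y"
    proof -
      have "solves x (S1 \<union> S2)" "solves y (S1 \<union> S2)" and s3: "solves x ?S" "solves y ?S"
        using s by (simp_all only: solves_Un)
      then have "agree n2 x y" using 12 ag unfolding unique_extension_def by blast
      then show ?thesis using 3 s3 unfolding unique_extension_def by blast
    qed
  next
    show "S1 \<union> S2 \<union> ?S \<subseteq> G (n2 + 1)"
      using sub(1) G_mono[of n2 "n2 + 1"] 3 unfolding unique_extension_def by auto
  qed (use sub in simp)
  moreover have "n2 + 1 \<le> n + (s + t + 1)" using 1(1) 2(1) by simp
  ultimately show "\<exists>n' S. n' \<le> n + (s + t + 1) \<and> unique_extension n n' S (\<lambda>x. f x = g x)"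
    by blast
qed

lemma expressible_conj:
  assumes P: "expressible k s P" and Q: "expressible k t Q"
  shows "expressible k (s + t) (\<lambda>x. P x \<and> Q x)"
  unfolding expressible_def
proof (intro conjI allI impI)
  show "local_at k (\<lambda>x. P x \<and> Q x)"
    using P Q unfolding expressible_def local_at_def by metis
  fix n assume n: "k \<le> n"
  obtain n1 S1 where 1: "n1 \<le> n + s" "unique_extension n n1 S1 P"
    using P n unfolding expressible_def by blast
  then have n1: "k \<le> n1" using n by (auto simp: unique_extension_def)
  obtain n2 S2 where 2: "n2 \<le> n1 + t" "unique_extension n1 n2 S2 Q"
    using Q n1 unfolding expressible_def by blast
  have "Q y" if "agree n x y" "Q x" for x y
    using Q that agree_mono[OF that(1) n] unfolding expressible_def local_at_def by blast
  then have "unique_extension n n2 (S1 \<union> S2) (\<lambda>x. P x \<and> Q x)"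
    using unique_extension_compose[OF 1(2) 2(2)] by blast
  moreover have "n2 \<le> n + (s + t)" using 1 2 by simp
  ultimately show "\<exists>n' S. n' \<le> n + (s + t) \<and> unique_extension n n' S (\<lambda>x. P x \<and> Q x)" by blast
qed

lemma expressible_ball:
  assumes "finite A" "\<And>a. a \<in> A \<Longrightarrow> expressible k s (P a)"
  shows "expressible k (card A * s) (\<lambda>x. \<forall>a\<in>A. P a x)"
  using assms
proof (induction A)
  case empty
  have "unique_extension n n {} (\<lambda>_. True)" for n
    by (auto simp: unique_extension_def solves_def intro: agree_refl)
  then show ?case unfolding expressible_def local_at_def by auto
next
  case (insert a A)
  have "expressible k (s + card A * s) (\<lambda>x. P a x \<and> (\<forall>a\<in>A. P a x))"
    by (intro expressible_conj insert.IH) (use insert.prems in auto)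
  then show ?case using insert.hyps by simp
qed

text \<open>
  Restriction to the first \<open>k\<close> unknowns is injective on the solutions of the system for \<open>R\<close>, so the
  system inherits finiteness from \<open>R\<close>, and the conjecture can be applied to it. A solution of \<open>R\<close>
  extends to one of the system and is thereby bounded.
\<close>

theorem conjecture_A_bound:
  assumes "conjecture_A" and R: "expressible k s R" and k: "k \<ge> 1"
    and fin: "finite {x \<in> {1..k} \<rightarrow>\<^sub>E UNIV. R x}" and x: "R x" and i: "i \<in> {1..k}"
  shows "x i \<le> tower (2 * (k + s))"
proof -
  obtain n S where n: "n \<le> k + s" and S: "unique_extension k n S R"
    using R unfolding expressible_def by blast
  note S' = S[unfolded unique_extension_def]
  have kn: "k \<le> n" and sub: "S \<subseteq> G n" using S' by auto
  have sols: "nat_solutions n S = {y \<in> {1..n} \<rightarrow>\<^sub>E UNIV. solves y S}"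
    by (simp add: nat_solutions_def solves_def)
  have restr: "agree m y (restrict y {1..m})" for m and y :: "nat \<Rightarrow> nat"
    by (simp add: agree_def)
  have loc: "R y \<longleftrightarrow> R z" if "agree k y z" for y z
    using R that unfolding expressible_def local_at_def by blast
  have "finite (nat_solutions n S)"
  proof (rule inj_on_finite[OF _ _ fin])
    show "inj_on (\<lambda>y. restrict y {1..k}) (nat_solutions n S)"
    proof (rule inj_onI)
      fix y z assume yz: "y \<in> nat_solutions n S" "z \<in> nat_solutions n S"
        "restrict y {1..k} = restrict z {1..k}"
      then have "agree k y z" by (metis restr agree_sym agree_trans)
      then have "agree n y z" using yz(1,2) S' unfolding sols by blast
      then show "y = z" using yz(1,2) unfolding sols agree_def by (auto intro: PiE_ext)
    qed
    show "(\<lambda>y. restrict y {1..k}) ` nat_solutions n S \<subseteq> {x \<in> {1..k} \<rightarrow>\<^sub>E UNIV. R x}"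
      using S' loc[OF restr] unfolding sols by auto
  qed
  moreover obtain y where y: "agree k x y" "solves y S" using S' x by blast
  moreover have "restrict y {1..n} \<in> nat_solutions n S"
    using y(2) solves_cong[OF sub restr] unfolding sols by simp
  moreover have "n \<ge> 1" "i \<in> {1..n}" using k kn i by auto
  ultimately have "restrict y {1..n} i \<le> tower (2 * n)"
    using assms(1) sub unfolding conjecture_A_def by blast
  also have "\<dots> \<le> tower (2 * (k + s))" using n by (intro tower_mono) simp
  finally show ?thesis using y(1) i \<open>i \<in> {1..n}\<close> by (simp add: agree_def)
qed

section \<open>Reduced fractions\<close>

text \<open>
  \<open>u\<close> is the residue of \<open>- 1 / a\<close> modulo \<open>c\<close>, and \<open>w\<close> is the slack that expresses \<open>u < c\<close>. The
  case \<open>c = 1\<close> is included, with \<open>u = 0\<close> and \<open>v = 1\<close>.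
\<close>

lemma bezout_witness:
  fixes a c :: nat
  assumes "coprime a c" "c > 0"
  obtains u w v where "c = u + w + 1" "v * c = u * a + 1"
proof -
  obtain r s :: int where rs: "r * int a + s * int c = 1"
    using bezout_int[of "int a" "int c"] assms(1) by auto
  define u where "u = nat ((- r) mod int c)"
  define q where "q = (- r) div int c"
  have u: "int u = - r - int c * q" "u < c"
    using assms(2) by (auto simp: u_def q_def minus_mult_div_eq_mod nat_less_iff)
  have "int u * int a + 1 = int u * int a + (r * int a + s * int c)" using rs by simp
  also have "\<dots> = int c * (s - q * int a)" unfolding u(1) by (simp add: algebra_simps)
  finally have "int (u * a + 1) = int c * (s - q * int a)" by simp
  then have "int c dvd int (u * a + 1)" by (rule dvdI)
  then have "c dvd u * a + 1" by (simp only: int_dvd_int_iff)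
  then obtain v where "u * a + 1 = c * v" by (elim dvdE)
  moreover obtain w where "c = u + w + 1" using u(2) less_natE by auto
  ultimately show ?thesis using that by (simp add: mult.commute)
qed

lemma bezout_witness_coprime:
  fixes a c :: nat
  assumes "v * c = u * a + 1"
  shows "coprime a c"
proof (rule coprimeI)
  fix d assume "d dvd a" "d dvd c"
  then have "d dvd u * a" "d dvd u * a + 1" unfolding assms[symmetric] by simp_all
  then show "is_unit d" using dvd_add_right_iff by blast
qed

text \<open>
  Two candidates for \<open>u\<close> are congruent modulo \<open>c\<close>, because \<open>a\<close> is invertible there; being smaller
  than \<open>c\<close> they are equal.
\<close>

lemma bezout_witness_unique:
  fixes a c :: nat
  assumes "v * c = u * a + 1" "v' * c = u' * a + 1" "u < c" "u' < c"
  shows "u = u'" "v = v'"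
proof -
  have *: "u = u'" if "v * c = u * a + 1" "v' * c = u' * a + 1" "u' < c" "u \<le> u'" for u u' v v'
  proof (rule ccontr)
    assume "u \<noteq> u'"
    have "(v' - v) * c = (u' - u) * a" using that(1,2) by (simp add: diff_mult_distrib)
    then have "c dvd (u' - u) * a" by (metis dvd_triv_right)
    then have "c dvd u' - u"
      using bezout_witness_coprime[OF that(1)] by (simp add: coprime_commute coprime_dvd_mult_left_iff)
    then show False using \<open>u \<noteq> u'\<close> that(3,4) by (auto dest: dvd_imp_le)
  qed
  show u: "u = u'" using *[OF assms(1,2,4)] *[OF assms(2,1,3)] by linarith
  show "v = v'" using assms u by (metis less_zeroE mult_right_cancel)
qed

section \<open>Rational solutions as solutions in non-negative integers\<close>

text \<open>
  The \<open>i\<close>-th coordinate of a rational point occupies four unknowns: the absolute value of the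
  numerator at \<open>i\<close>, and the numbers \<open>u\<close>, \<open>w\<close>, \<open>v\<close> of \<open>bezout_witness\<close> at \<open>p + i\<close>, \<open>2 * p + i\<close> and
  \<open>3 * p + i\<close>. The denominator \<open>u + w + 1\<close> needs no unknown of its own and is visibly positive.
\<close>

definition denominator :: "nat \<Rightarrow> (nat \<Rightarrow> nat) \<Rightarrow> nat \<Rightarrow> nat" where
  "denominator p x i = x (p + i) + x (2 * p + i) + 1"

definition rational_point :: "nat \<Rightarrow> (nat \<Rightarrow> int) \<Rightarrow> (nat \<Rightarrow> nat) \<Rightarrow> nat \<Rightarrow> rat" where
  "rational_point p \<sigma> x =
    (\<lambda>i\<in>{1..p}. of_int (\<sigma> i) * of_nat (x i) / of_nat (denominator p x i))"

definition reduced :: "nat \<Rightarrow> (nat \<Rightarrow> nat) \<Rightarrow> bool" where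
  "reduced p x \<longleftrightarrow> (\<forall>i\<in>{1..p}. x (3 * p + i) * denominator p x i = x (p + i) * x i + 1)"

definition signed_coeff :: "nat \<Rightarrow> int_poly \<Rightarrow> (nat \<Rightarrow> int) \<Rightarrow> (nat \<Rightarrow>\<^sub>0 nat) \<Rightarrow> int" where
  "signed_coeff p D \<sigma> m = Poly_Mapping.lookup D m * (\<Prod>i\<in>{1..p}. \<sigma> i ^ Poly_Mapping.lookup m i)"

text \<open>
  The sum of \<open>c m\<close> times the monomial \<open>m\<close> at the point \<open>x i / denominator p x i\<close>, multiplied by the
  \<open>d\<close>-th power of each denominator. The natural number \<open>d - lookup m i\<close> is a true difference only
  if \<open>d\<close> bounds all exponents.
\<close>

definition homogenised ::
    "nat \<Rightarrow> nat \<Rightarrow> int_poly \<Rightarrow> ((nat \<Rightarrow>\<^sub>0 nat) \<Rightarrow> nat) \<Rightarrow> (nat \<Rightarrow> nat) \<Rightarrow> nat" where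
  "homogenised p d D c x = (\<Sum>m\<in>Poly_Mapping.keys D. c m *
    (\<Prod>i\<in>{1..p}. x i ^ Poly_Mapping.lookup m i *
      denominator p x i ^ (d - Poly_Mapping.lookup m i)))"

text \<open>
  An integer \<open>e\<close> is \<open>nat e - nat (- e)\<close>; using this for each coefficient puts the terms on the side
  on which they are non-negative.
\<close>

definition encoded_equation ::
    "nat \<Rightarrow> nat \<Rightarrow> int_poly \<Rightarrow> (nat \<Rightarrow> int) \<Rightarrow> (nat \<Rightarrow> nat) \<Rightarrow> bool" where
  "encoded_equation p d D \<sigma> x \<longleftrightarrow> reduced p x \<and>
     homogenised p d D (\<lambda>m. nat (signed_coeff p D \<sigma> m)) x =
     homogenised p d D (\<lambda>m. nat (- signed_coeff p D \<sigma> m)) x"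

lemma poly_value_rational_point:
  assumes d: "\<And>m i. m \<in> Poly_Mapping.keys D \<Longrightarrow> i \<in> {1..p} \<Longrightarrow> Poly_Mapping.lookup m i \<le> d"
  shows "poly_value p D (rational_point p \<sigma> x) * (\<Prod>i\<in>{1..p}. of_nat (denominator p x i) ^ d) =
    of_nat (homogenised p d D (\<lambda>m. nat (signed_coeff p D \<sigma> m)) x) -
    of_nat (homogenised p d D (\<lambda>m. nat (- signed_coeff p D \<sigma> m)) x)"
proof -
  let ?c = "\<lambda>i. of_nat (denominator p x i) :: rat"
  let ?e = "\<lambda>m. Poly_Mapping.lookup m"
  let ?M = "\<lambda>m. (\<Prod>i\<in>{1..p}. of_nat (x i) ^ ?e m i * ?c i ^ (d - ?e m i))"
  have c0: "?c i \<noteq> 0" for i by (simp add: denominator_def)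
  have fac: "rational_point p \<sigma> x i ^ ?e m i * ?c i ^ d
      = of_int (\<sigma> i ^ ?e m i) * (of_nat (x i) ^ ?e m i * ?c i ^ (d - ?e m i))"
    if "m \<in> Poly_Mapping.keys D" "i \<in> {1..p}" for m i
  proof -
    have "?c i ^ d = ?c i ^ ?e m i * ?c i ^ (d - ?e m i)"
      using d[OF that] by (simp flip: power_add)
    then show ?thesis
      using that(2) c0[of i] by (simp add: rational_point_def power_divide power_mult_distrib)
  qed
  have "of_int (?e D m) * (\<Prod>i\<in>{1..p}. rational_point p \<sigma> x i ^ ?e m i) * (\<Prod>i\<in>{1..p}. ?c i ^ d)
      = of_int (signed_coeff p D \<sigma> m) * ?M m" if "m \<in> Poly_Mapping.keys D" for m
  proof -
    have "(\<Prod>i\<in>{1..p}. rational_point p \<sigma> x i ^ ?e m i) * (\<Prod>i\<in>{1..p}. ?c i ^ d)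
        = (\<Prod>i\<in>{1..p}. of_int (\<sigma> i ^ ?e m i) * (of_nat (x i) ^ ?e m i * ?c i ^ (d - ?e m i)))"
      unfolding prod.distrib[symmetric] by (rule prod.cong) (use fac[OF that] in auto)
    also have "\<dots> = of_int (\<Prod>i\<in>{1..p}. \<sigma> i ^ ?e m i) * ?M m"
      by (simp add: prod.distrib)
    finally show ?thesis by (simp add: signed_coeff_def mult.assoc)
  qed
  moreover have "of_int e = (of_nat (nat e) - of_nat (nat (- e)) :: rat)" for e
    by (cases "e \<ge> 0") auto
  ultimately show ?thesis
    unfolding poly_value_def homogenised_def sum_distrib_right
    by (simp add: left_diff_distrib sum_subtractf)
qed

lemma encoded_equation_iff:
  assumes "\<And>m i. m \<in> Poly_Mapping.keys D \<Longrightarrow> i \<in> {1..p} \<Longrightarrow> Poly_Mapping.lookup m i \<le> d"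
  shows "encoded_equation p d D \<sigma> x \<longleftrightarrow>
    reduced p x \<and> rational_point p \<sigma> x \<in> rat_solutions p D"
proof -
  have "(\<Prod>i\<in>{1..p}. of_nat (denominator p x i) ^ d) \<noteq> (0::rat)"
    by (simp add: denominator_def)
  then have "poly_value p D (rational_point p \<sigma> x) = 0 \<longleftrightarrow>
     homogenised p d D (\<lambda>m. nat (signed_coeff p D \<sigma> m)) x =
     homogenised p d D (\<lambda>m. nat (- signed_coeff p D \<sigma> m)) x"
    using poly_value_rational_point[of D p d \<sigma> x, OF assms]
    by (metis eq_iff_diff_eq_0 mult_eq_0_iff of_nat_eq_iff)
  then show ?thesis
    by (auto simp: encoded_equation_def rat_solutions_def rational_point_def)
qed

text \<open>
  A rational number has one representation in lowest terms, and that has one Bezout witness. This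
  is what makes the system finite when the set of rational solutions is.
\<close>

lemma rational_point_inject:
  assumes \<sigma>: "\<And>i. \<bar>\<sigma> i\<bar> = 1" and x: "reduced p x" and y: "reduced p y"
    and eq: "rational_point p \<sigma> x = rational_point p \<sigma> y" and l: "l \<in> {1..4 * p}"
  shows "x l = y l"
proof -
  have coords: "x i = y i \<and> x (p + i) = y (p + i) \<and> x (2 * p + i) = y (2 * p + i) \<and>
      x (3 * p + i) = y (3 * p + i)" if i: "i \<in> {1..p}" for i
  proof -
    let ?c = "denominator p x i" and ?c' = "denominator p y i"
    have wx: "x (3 * p + i) * ?c = x (p + i) * x i + 1"
      and wy: "y (3 * p + i) * ?c' = y (p + i) * y i + 1"
      using x y i by (auto simp: reduced_def)
    have "of_int (\<sigma> i) * of_nat (x i) / of_nat ?c = (of_int (\<sigma> i) * of_nat (y i) / of_nat ?c' :: rat)"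
      using fun_cong[OF eq, of i] i by (simp add: rational_point_def)
    moreover have "of_int (\<sigma> i) \<noteq> (0::rat)" "of_nat ?c \<noteq> (0::rat)" "of_nat ?c' \<noteq> (0::rat)"
      using \<sigma>[of i] by (auto simp: denominator_def)
    ultimately have "of_nat (x i * ?c') = (of_nat (y i * ?c) :: rat)"
      by (simp add: frac_eq_eq mult.assoc)
    then have "x i * ?c' = y i * ?c" by (simp only: of_nat_eq_iff)
    then have xc: "x i = y i" "?c = ?c'"
      using coprime_crossproduct_nat[of "x i" ?c "y i" ?c']
        bezout_witness_coprime[OF wx] bezout_witness_coprime[OF wy] by (auto simp: mult.commute)
    have "x (p + i) < ?c" "y (p + i) < ?c" using xc(2) by (simp_all add: denominator_def)
    then have "x (p + i) = y (p + i)" "x (3 * p + i) = y (3 * p + i)"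
      using bezout_witness_unique[OF wx] wy xc by metis+
    then show ?thesis using xc by (simp add: denominator_def)
  qed
  consider "l \<in> {1..p}" | "l - p \<in> {1..p}" "l = p + (l - p)"
    | "l - 2 * p \<in> {1..p}" "l = 2 * p + (l - 2 * p)"
    | "l - 3 * p \<in> {1..p}" "l = 3 * p + (l - 3 * p)"
    using l by force
  then show ?thesis by cases (use coords in metis)+
qed

text \<open>
  All powers, multiples and sums are written out in unary, so the count is a polynomial in \<open>K\<close>. The
  denominators cost 26 unknowns each (two additions of 12 and the constant 1), a factor
  \<open>a ^ k * c ^ (K - k)\<close> at most \<open>28 * K + 5\<close>, and the coprimality equation of a coordinate 43. The
  exponent of homogenisation is \<open>K\<close> itself.
\<close>

lemma expressible_encoded_equation:
  assumes exponents: "\<And>m i. m \<in> Poly_Mapping.keys D \<Longrightarrow> i \<in> {1..p} \<Longrightarrow> Poly_Mapping.lookup m i \<le> K"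
    and coeffs: "\<And>m. m \<in> Poly_Mapping.keys D \<Longrightarrow> \<bar>Poly_Mapping.lookup D m\<bar> \<le> int K"
    and terms: "card (Poly_Mapping.keys D) \<le> K" and p: "p \<le> K" and \<sigma>: "\<And>i. \<bar>\<sigma> i\<bar> = 1"
  shows "expressible (4 * p) (K * 43 + (2 * (K * (K * (28 * K + 6) + 14 * K + 17) + 2) + 1))
    (encoded_equation p K D \<sigma>)"
proof -
  have coord: "computed (4 * p) 0 (\<lambda>x. x (j * p + i))" if "i \<in> {1..p}" "j \<le> 3" for i j
  proof -
    have "j * p \<le> 3 * p" using that(2) by (rule mult_le_mono1)
    moreover have "i \<le> p" "1 \<le> i" using that(1) by auto
    ultimately have "j * p + i \<in> {1..4 * p}" by (simp only: atLeastAtMost_iff) linarith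
    then show ?thesis by (rule computed_coordinate)
  qed
  have coords: "computed (4 * p) 0 (\<lambda>x. x i)" "computed (4 * p) 0 (\<lambda>x. x (p + i))"
    "computed (4 * p) 0 (\<lambda>x. x (2 * p + i))" "computed (4 * p) 0 (\<lambda>x. x (3 * p + i))"
    if "i \<in> {1..p}" for i
    using coord[OF that, of 0] coord[OF that, of 1] coord[OF that, of 2] coord[OF that, of 3]
    by simp_all
  have one: "computed (4 * p) 2 (\<lambda>_. 1)" by (rule computed_bit) simp
  have den: "computed (4 * p) 26 (\<lambda>x. denominator p x i)" if "i \<in> {1..p}" for i
    using computed_add[OF computed_add[OF coords(2)[OF that] coords(3)[OF that]] one]
    unfolding denominator_def by simp
  have factor: "computed (4 * p) (28 * K + 5) (\<lambda>x. x i ^ Poly_Mapping.lookup m i *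
      denominator p x i ^ (K - Poly_Mapping.lookup m i))"
    if m: "m \<in> Poly_Mapping.keys D" and i: "i \<in> {1..p}" for m i
  proof (rule computed_mono)
    show "computed (4 * p) ((Poly_Mapping.lookup m i * (0 + 1) + 2)
        + ((K - Poly_Mapping.lookup m i) * (26 + 1) + 2) + 1)
       (\<lambda>x. x i ^ Poly_Mapping.lookup m i * denominator p x i ^ (K - Poly_Mapping.lookup m i))"
      using i by (intro computed_mult computed_power den coords) auto
  qed (use exponents[OF m i] in simp)
  have hom: "computed (4 * p) (K * (K * (28 * K + 6) + 14 * K + 17) + 2) (homogenised p K D c)"
    if c: "\<And>m. m \<in> Poly_Mapping.keys D \<Longrightarrow> c m \<le> K" for c
  proof -
    have "computed (4 * p) (K * (28 * K + 6) + 14 * K + 5) (\<lambda>x. c m *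
       (\<Prod>i\<in>{1..p}. x i ^ Poly_Mapping.lookup m i * denominator p x i ^ (K - Poly_Mapping.lookup m i)))"
      if m: "m \<in> Poly_Mapping.keys D" for m
    proof (rule computed_mono)
      show "computed (4 * p) ((14 * c m + 2) + (card {1..p} * (28 * K + 5 + 1) + 2) + 1) (\<lambda>x. c m *
         (\<Prod>i\<in>{1..p}. x i ^ Poly_Mapping.lookup m i * denominator p x i ^ (K - Poly_Mapping.lookup m i)))"
        by (intro computed_mult computed_const computed_prod factor m) auto
      show "14 * c m + 2 + (card {1..p} * (28 * K + 5 + 1) + 2) + 1 \<le> K * (28 * K + 6) + 14 * K + 5"
      proof -
        have "card {1..p} * (28 * K + 5 + 1) \<le> K * (28 * K + 6)"
          by (rule mult_le_mono) (use p in auto)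
        then show ?thesis using c[OF m] by linarith
      qed
    qed
    then have "computed (4 * p) (card (Poly_Mapping.keys D) * (K * (28 * K + 6) + 14 * K + 5 + 12) + 2)
        (homogenised p K D c)"
      unfolding homogenised_def by (rule computed_sum[OF finite_keys])
    then show ?thesis
      by (rule computed_mono) (rule add_right_mono, rule mult_le_mono, use terms in simp_all)
  qed
  have "\<bar>\<Prod>i\<in>{1..p}. \<sigma> i ^ Poly_Mapping.lookup m i\<bar> = 1" for m
    using finite_atLeastAtMost[of 1 p]
    by (induction rule: finite_induct) (simp_all add: abs_mult power_abs \<sigma>)
  then have "\<bar>signed_coeff p D \<sigma> m\<bar> = \<bar>Poly_Mapping.lookup D m\<bar>" for m
    by (simp add: signed_coeff_def abs_mult)
  then have e: "nat (signed_coeff p D \<sigma> m) \<le> K" "nat (- signed_coeff p D \<sigma> m) \<le> K"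
    if "m \<in> Poly_Mapping.keys D" for m using coeffs[OF that] by (metis abs_le_iff nat_le_iff)+
  have "expressible (4 * p) 43 (\<lambda>x. x (3 * p + i) * denominator p x i = x (p + i) * x i + 1)"
    if i: "i \<in> {1..p}" for i
  proof -
    have "expressible (4 * p) ((0 + 26 + 1) + ((0 + 0 + 1) + 2 + 12) + 1)
        (\<lambda>x. x (3 * p + i) * denominator p x i = x (p + i) * x i + 1)"
      using i by (intro expressible_eq computed_add computed_mult den coords one) auto
    then show ?thesis by simp
  qed
  then have "expressible (4 * p) (card {1..p} * 43) (reduced p)"
    unfolding reduced_def by (rule expressible_ball[OF finite_atLeastAtMost])
  then have "expressible (4 * p) (card {1..p} * 43 + (2 * (K * (K * (28 * K + 6) + 14 * K + 17) + 2) + 1))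
    (encoded_equation p K D \<sigma>)"
    unfolding encoded_equation_def mult_2
    by (intro expressible_conj expressible_eq hom e)
  then show ?thesis by (rule expressible_mono) (use p in simp)
qed

text \<open>
  The cubic count, including at most \<open>4 * K\<close> unknowns for the rational point, is replaced by a power of two, for
  which a program is easier to give. The right-hand side is \<open>256 * (2 ^ K) ^ 4\<close>.
\<close>

lemma unknowns_bound:
  "4 * K + (K * 43 + (2 * (K * (K * (28 * K + 6) + 14 * K + 17) + 2) + 1)) \<le> 2 ^ (4 * K + 8)"
proof -
  have K: "K \<le> 2 ^ K" "1 \<le> (2::nat) ^ K" by (simp_all add: less_imp_le)
  let ?t = "(2::nat) ^ K"
  have "28 * K + 6 \<le> 34 * ?t" using K by linarith
  then have "K * (28 * K + 6) \<le> ?t * (34 * ?t)" using K(1) by (intro mult_le_mono)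
  moreover have "14 * K + 17 \<le> ?t * (31 * ?t)"
  proof -
    have "14 * K + 17 \<le> 31 * ?t" using K by linarith
    also have "\<dots> \<le> ?t * (31 * ?t)" using K(2) by simp
    finally show ?thesis .
  qed
  ultimately have "K * (K * (28 * K + 6) + 14 * K + 17) \<le> ?t * (65 * ?t * ?t)"
    using K by (intro mult_le_mono) auto
  moreover have "47 * K + 5 \<le> 52 * (?t * ?t * ?t)"
  proof -
    have "47 * K + 5 \<le> 52 * ?t" using K by linarith
    also have "\<dots> \<le> 52 * (?t * ?t * ?t)" by simp
    finally show ?thesis .
  qed
  ultimately have "4 * K + (K * 43 + (2 * (K * (K * (28 * K + 6) + 14 * K + 17) + 2) + 1))
      \<le> 256 * (?t * ?t * ?t)" by simp
  also have "\<dots> \<le> 256 * (?t * ?t * ?t) * ?t" by simp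
  also have "\<dots> = 2 ^ (4 * K + 8)"
    by (simp add: power_add power_mult mult.commute power4_eq_xxxx flip: power_mult_distrib)
  finally show ?thesis .
qed

text \<open>
  The system is built for the signs of the given solution \<open>r\<close>. Rational solutions with other
  signs are lost, but every solution of the system still comes from a rational one, which is all that
  finiteness needs. The denominators are sums \<open>u + w + 1\<close> of bounded unknowns, whence \<open>2 * _ + 1\<close>
  in the bound.
\<close>

theorem height_bound:
  assumes "conjecture_A" and p1: "p \<ge> 1"
    and exponents: "\<And>m i. m \<in> Poly_Mapping.keys D \<Longrightarrow> i \<in> {1..p} \<Longrightarrow> Poly_Mapping.lookup m i \<le> K"
    and coeffs: "\<And>m. m \<in> Poly_Mapping.keys D \<Longrightarrow> \<bar>Poly_Mapping.lookup D m\<bar> \<le> int K"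
    and terms: "card (Poly_Mapping.keys D) \<le> K" and p: "p \<le> K"
    and fin: "finite (rat_solutions p D)" and r: "r \<in> rat_solutions p D"
  shows "tuple_height p r \<le> 2 * int (tower (2 * 2 ^ (4 * K + 8))) + 1"
proof -
  define \<sigma> where "\<sigma> i = (if r i < 0 then - 1 else 1 :: int)" for i
  have \<sigma>: "\<bar>\<sigma> i\<bar> = 1" for i by (simp add: \<sigma>_def)
  define a c where "a i = nat \<bar>fst (quotient_of (r i))\<bar>" and "c i = nat (snd (quotient_of (r i)))" for i
  have cop: "coprime (a i) (c i)" "c i > 0" and ri: "r i = of_int (\<sigma> i) * of_nat (a i) / of_nat (c i)"
    and height: "height (r i) = max (int (a i)) (int (c i))" for i
  proof -
    obtain n d where nd: "quotient_of (r i) = (n, d)" by force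
    have d: "d > 0" and cp: "coprime n d" and q: "r i = of_int n / of_int d"
      using quotient_of_denom_pos[OF nd] quotient_of_coprime[OF nd] quotient_of_div[OF nd] by auto
    have ac: "int (a i) = \<bar>n\<bar>" "int (c i) = d" using nd d by (simp_all add: a_def c_def)
    show "c i > 0" using ac d by simp
    have "coprime (int (a i)) (int (c i))" using cp unfolding ac by simp
    then show "coprime (a i) (c i)" by simp
    show "height (r i) = max (int (a i)) (int (c i))" using nd d ac by (simp add: height_def)
    have "r i < 0 \<longleftrightarrow> n < 0" using q d by (simp add: divide_less_0_iff)
    then have "n = \<sigma> i * int (a i)" unfolding ac \<sigma>_def by simp
    then show "r i = of_int (\<sigma> i) * of_nat (a i) / of_nat (c i)"
      using q ac(2) by (metis of_int_mult of_int_of_nat_eq)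
  qed
  have "\<exists>u w v. c i = u + w + 1 \<and> v * c i = u * a i + 1" for i
    using bezout_witness[OF cop] by metis
  then obtain u w v where uwv: "\<And>i. c i = u i + w i + 1" "\<And>i. v i * c i = u i * a i + 1" by metis
  define x where "x l = (if l \<le> p then a l else if l \<le> 2 * p then u (l - p)
    else if l \<le> 3 * p then w (l - 2 * p) else v (l - 3 * p))" for l
  have x: "x i = a i" "x (p + i) = u i" "x (2 * p + i) = w i" "x (3 * p + i) = v i"
    if "i \<in> {1..p}" for i using that by (auto simp: x_def)
  have den: "denominator p x i = c i" if "i \<in> {1..p}" for i
    using x[OF that] uwv(1) by (simp add: denominator_def)
  have "rational_point p \<sigma> x = r"
  proof
    fix i show "rational_point p \<sigma> x i = r i"
      using r x den ri by (cases "i \<in> {1..p}")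
        (auto simp: rational_point_def rat_solutions_def PiE_def extensional_def)
  qed
  moreover have "reduced p x" unfolding reduced_def using x den uwv(2) by simp
  moreover note iff = encoded_equation_iff[of D p K \<sigma>, OF exponents]
  ultimately have sol: "encoded_equation p K D \<sigma> x" using r by simp
  let ?X = "{x \<in> {1..4 * p} \<rightarrow>\<^sub>E UNIV. encoded_equation p K D \<sigma> x}"
  have "finite ?X"
  proof (rule inj_on_finite[OF _ _ fin])
    show "inj_on (rational_point p \<sigma>) ?X"
    proof (rule inj_onI)
      fix y z assume yz: "y \<in> ?X" "z \<in> ?X" "rational_point p \<sigma> y = rational_point p \<sigma> z"
      have "y l = z l" if "l \<in> {1..4 * p}" for l
      proof (rule rational_point_inject[where p = p and \<sigma> = \<sigma> and x = y and y = z])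
        show "reduced p y" "reduced p z" using yz(1,2) iff by simp_all
      qed (fact \<sigma> yz(3) that)+
      then show "y = z"
        using yz(1,2) by (intro PiE_ext[where k = "{1..4 * p}" and s = "\<lambda>_. UNIV"]) auto
    qed
    show "rational_point p \<sigma> ` ?X \<subseteq> rat_solutions p D" using iff by (simp add: image_subset_iff)
  qed
  have expr: "expressible (4 * p)
      (K * 43 + (2 * (K * (K * (28 * K + 6) + 14 * K + 17) + 2) + 1)) (encoded_equation p K D \<sigma>)"
    by (rule expressible_encoded_equation; fact exponents coeffs terms p \<sigma>)
  have bound:
    "x l \<le> tower (2 * (4 * p + (K * 43 + (2 * (K * (K * (28 * K + 6) + 14 * K + 17) + 2) + 1))))"
    if "l \<in> {1..4 * p}" for l
  proof (rule conjecture_A_bound[where x = x and k = "4 * p" and R = "encoded_equation p K D \<sigma>"])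
    show "4 * p \<ge> 1" using p1 by simp
  qed (fact \<open>conjecture_A\<close> expr \<open>finite ?X\<close> sol that)+
  define T where "T = tower (2 * 2 ^ (4 * K + 8))"
  have T: "x l \<le> T" if "l \<in> {1..4 * p}" for l
  proof -
    note bound[OF that]
    also have "tower (2 * (4 * p +
        (K * 43 + (2 * (K * (K * (28 * K + 6) + 14 * K + 17) + 2) + 1)))) \<le> T" unfolding T_def
      using unknowns_bound[of K] p by (intro tower_mono mult_le_mono2) linarith
    finally show ?thesis .
  qed
  have "height (r i) \<le> 2 * int T + 1" if i: "i \<in> {1..p}" for i
    using T[of i] T[of "p + i"] T[of "2 * p + i"] x[OF i] uwv(1)[of i] i by (simp add: height)
  then show ?thesis unfolding tuple_height_def T_def[symmetric] using p1 by simp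
qed

section \<open>The bound as a function of the code of the equation\<close>

lemma member_le_list_encode: "n \<in> set ns \<Longrightarrow> n \<le> list_encode ns"
proof (induction ns)
  case (Cons k ns)
  then show ?case
    using le_prod_encode_1[of k "list_encode ns"] le_prod_encode_2[of "list_encode ns" k] by auto
qed simp

lemma length_le_list_encode: "length ns \<le> list_encode ns"
proof (induction ns)
  case (Cons k ns)
  then show ?case using le_prod_encode_2[of "list_encode ns" k] by simp
qed simp

lemma abs_le_int_encode: "\<bar>c\<bar> \<le> int (int_encode c)"
  by (auto simp: int_encode_def sum_encode_def)

text \<open>
  The pairing function dominates both of its arguments, so every number that enters the code is at
  most the code; a list code increases with each entry, so the number of terms is bounded as well.
\<close>

lemma dioph_code_bounds:
  shows "p \<le> dioph_code p D"
    and "card (Poly_Mapping.keys D) \<le> dioph_code p D"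
    and "m \<in> Poly_Mapping.keys D \<Longrightarrow> i \<in> {1..p} \<Longrightarrow> Poly_Mapping.lookup m i \<le> dioph_code p D"
    and "m \<in> Poly_Mapping.keys D \<Longrightarrow> \<bar>Poly_Mapping.lookup D m\<bar> \<le> int (dioph_code p D)"
proof -
  let ?g = "\<lambda>(m, c). prod_encode (list_encode (map (Poly_Mapping.lookup m) [1..<Suc p]), int_encode c)"
  let ?l = "map ?g (Poly_Mapping.items D)"
  have code: "dioph_code p D = prod_encode (p, list_encode ?l)" by (simp add: dioph_code_def)
  then show "p \<le> dioph_code p D" by (simp only: le_prod_encode_1)
  have l: "list_encode ?l \<le> dioph_code p D" unfolding code by (rule le_prod_encode_2)
  show "card (Poly_Mapping.keys D) \<le> dioph_code p D"
    using length_le_list_encode[of ?l] l by (simp add: Poly_Mapping.items_def)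
  assume "m \<in> Poly_Mapping.keys D"
  then have "?g (m, Poly_Mapping.lookup D m) \<in> set ?l" by force
  then have "?g (m, Poly_Mapping.lookup D m) \<le> dioph_code p D"
    using member_le_list_encode l le_trans by blast
  then have m: "list_encode (map (Poly_Mapping.lookup m) [1..<Suc p]) \<le> dioph_code p D"
    and c: "int_encode (Poly_Mapping.lookup D m) \<le> dioph_code p D"
    unfolding prod.case using le_prod_encode_1 le_prod_encode_2 le_trans by blast+
  show "\<bar>Poly_Mapping.lookup D m\<bar> \<le> int (dioph_code p D)"
    using abs_le_int_encode[of "Poly_Mapping.lookup D m"] c by linarith
  assume "i \<in> {1..p}"
  then have "Poly_Mapping.lookup m i \<in> set (map (Poly_Mapping.lookup m) [1..<Suc p])"
    by (simp only: set_map set_upt atLeastLessThanSuc_atLeastAtMost imageI)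
  then show "Poly_Mapping.lookup m i \<le> dioph_code p D"
    using member_le_list_encode m le_trans by blast
qed

theorem theorem4:
  assumes "conjecture_A"
  shows "\<exists>(P :: recf). \<forall>p\<ge>1. \<forall>D\<in>int_polys p.
    \<exists>b::int. recf_eval P [dioph_code p D] (int_encode b) \<and>
      (finite (rat_solutions p D) \<longrightarrow> (\<forall>x\<in>rat_solutions p D. tuple_height p x \<le> b))"
proof -
  \<comment> \<open>The exponent \<open>4 * K + 8\<close> in a form that is built from doubling and successors.\<close>
  define T where "T K = tower (Suc (2 * 2 ^ (2 * (2 * Suc (Suc K)))))" for K :: nat
  note compose = unary_recursive_comp[OF unary_recursive_Suc]
    unary_recursive_comp[OF unary_recursive_double]
    unary_recursive_comp[OF unary_recursive_power_of_two]
    unary_recursive_comp[OF unary_recursive_tower]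
  have "unary_recursive (\<lambda>K. 2 * (2 * Suc (Suc K)))"
    by (rule compose(2), rule compose(2), rule compose(1), rule unary_recursive_Suc)
  then have "unary_recursive T"
    unfolding T_def by (rule compose(4)[OF compose(2)[OF compose(3)]])
  then have "unary_recursive (\<lambda>K. 2 * Suc (2 * T K))"
    by (rule compose(2)[OF compose(1)[OF compose(2)]])
  then obtain P where P: "\<And>K. recf_eval P [K] (2 * Suc (2 * T K))"
    unfolding unary_recursive_def by blast
  show ?thesis
  proof (intro exI[of _ P] allI impI ballI)
    fix p D assume p: "1 \<le> p" and "D \<in> int_polys p"
    define K where "K = dioph_code p D"
    let ?b = "2 * int (T K) + 1"
    \<comment> \<open>Non-negative integers are coded by even numbers.\<close>
    have "int_encode ?b = 2 * Suc (2 * T K)"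
      by (simp add: int_encode_def sum_encode_def nat_add_distrib nat_mult_distrib)
    then have "recf_eval P [K] (int_encode ?b)" using P by simp
    moreover have "tuple_height p x \<le> ?b"
      if "finite (rat_solutions p D)" "x \<in> rat_solutions p D" for x
    proof -
      have "tuple_height p x \<le> 2 * int (tower (2 * 2 ^ (4 * K + 8))) + 1"
        unfolding K_def
        by (rule height_bound[OF assms p dioph_code_bounds(3,4,2,1) that])
      moreover have "tower (2 * 2 ^ (4 * K + 8)) \<le> T K"
      proof -
        have "2 * (2 * Suc (Suc K)) = 4 * K + 8" by simp
        then show ?thesis unfolding T_def by (simp only:) (rule tower_mono[OF le_SucI[OF order_refl]])
      qed
      ultimately show ?thesis by linarith
    qed
    ultimately show "\<exists>b. recf_eval P [dioph_code p D] (int_encode b) \<and>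
      (finite (rat_solutions p D) \<longrightarrow> (\<forall>x\<in>rat_solutions p D. tuple_height p x \<le> b))"
      unfolding K_def by blast
  qed
qed

end
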